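(* Let $i,j,k$ be nonnegative integers with $i+j+k\ge1$, and let $$P(z)=\prod\big(1-z^{n_1\cdots n_i d_1\cdots d_j e_1\cdots e_k}\big)^{-n_1\cdots n_i/(d_1\cdots d_j)},$$ the product taken over all $(i+j+k)$-tuples $(n_1,\dots,n_i,d_1,\dots,d_j,e_1,\dots,e_k)$ of positive integers (empty products of indices equal $1$), regarded as a formal power series in $z$. For every positive integer $n$, write the divisors of $n$ as $1=p_1<\dots<p_{\tau(n)}=n$, and for a divisor $p_\ell$ of $n$ write the divisors of $n/p_\ell$ as $q_1<\dots<q_{\tau(n/p_\ell)}$. Define $$\chi(n)=\begin{cases} n^2\,\tau_i(n) & \text{if } i\ge1,\ j=0,\ k=0,\\ n\sum_{\ell=1}^{\tau(n)}p_\ell\,\tau_i(p_\ell)\,\tau_k(n/p_\ell) & \text{if } i\ge1,\ j=0,\ k\ge1,\\ \sum_{\ell=1}^{\tau(n)}p_\ell^2\,\tau_i(p_\ell)\,\tau_j(n/p_\ell) & \text{if } i\ge1,\ j\ge1,\ k=0,\\ \sum_{\ell=1}^{\tau(n)}\sum_{m=1}^{\tau(n/p_\ell)}p_\ell^2\,q_m\,\tau_i(p_\ell)\,\tau_k(q_m)\,\tau_j\big(n/(p_\ell q_m)\big) & \text{if } i\ge1,\ j\ge1,\ k\ge1,\\ n\,\tau_k(n) & \text{if } i=0,\ j=0,\ k\ge1,\\ \sum_{\ell=1}^{\tau(n)}p_\ell\,\tau_k(p_\ell)\,\tau_j(n/p_\ell) & \text{if } i=0,\ j\ge1,\ k\ge1,\\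 \tau_j(n) & \text{if } i=0,\ j\ge1,\ k=0. \end{cases}$$ Then $$P(z)=\prod_{n\ge1}\exp\Big(\sum_{\ell=1}^{\infty}\frac{z^{n\ell}}{n\ell}\Big)^{\chi(n)}.$$
   Context: For $m\ge1$, $\tau_m(n)$ denotes the number of ordered $m$-tuples $(a_1,\dots,a_m)$ of positive integers with $a_1\cdots a_m=n$; in particular $\tau_1(n)=1$, and $\tau(n)=\tau_2(n)$ is the number of positive divisors of $n$. *)

theory Defs
  imports Complex_Main "HOL-Computational_Algebra.Formal_Power_Series"
begin

definition tau :: "nat \<Rightarrow> nat \<Rightarrow> nat" where
  "tau m n = card {as :: nat list. length as = m \<and> (\<forall>a\<in>set as. a > 0) \<and> prod_list as = n}"

(* Unordered infinite products of formal power series, with respect to the library's metric on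
   fps (the X-adic topology): limits of the finite subproducts along the directed set of finite
   subsets of the index set. *)
definition fps_multipliable_on :: "('i \<Rightarrow> 'a::comm_ring_1 fps) \<Rightarrow> 'i set \<Rightarrow> bool" where
  "fps_multipliable_on f A \<longleftrightarrow> (\<exists>L. ((\<lambda>F. \<Prod>x\<in>F. f x) \<longlongrightarrow> L) (finite_subsets_at_top A))"

definition fps_infprod :: "('i \<Rightarrow> 'a::comm_ring_1 fps) \<Rightarrow> 'i set \<Rightarrow> 'a fps" where
  "fps_infprod f A = Lim (finite_subsets_at_top A) (\<lambda>F. \<Prod>x\<in>F. f x)"

(* The power f ^ c with exponent c in the coefficient field, via the binomial series in f - 1;
   meaningful for series f with constant term 1. *)
definition fps_gpow :: "'a::field_char_0 fps \<Rightarrow> 'a \<Rightarrow> 'a fps" where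
  "fps_gpow f c = fps_binomial c oo (f - 1)"

(* The formal exponential of f; meaningful for series f with constant term 0. *)
definition fps_exp_of :: "'a::field_char_0 fps \<Rightarrow> 'a fps" where
  "fps_exp_of f = fps_exp 1 oo f"

definition pos_tuples :: "nat \<Rightarrow> nat list set" where
  "pos_tuples m = {as. length as = m \<and> (\<forall>a\<in>set as. a > 0)}"

definition P_factor :: "nat list \<times> nat list \<times> nat list \<Rightarrow> 'a::field_char_0 fps" where
  "P_factor = (\<lambda>(ns, ds, es).
     fps_gpow (1 - fps_X ^ (prod_list ns * prod_list ds * prod_list es))
              (- (of_nat (prod_list ns) / of_nat (prod_list ds))))"

definition P_indices :: "nat \<Rightarrow> nat \<Rightarrow> nat \<Rightarrow> (nat list \<times> nat list \<times> nat list) set" where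
  "P_indices i j k = pos_tuples i \<times> pos_tuples j \<times> pos_tuples k"

(* The series (SUM l>=1. z^(n l) / (n l)), shifted so that the summation starts at 0. *)
definition log_series :: "nat \<Rightarrow> 'a::field_char_0 fps" where
  "log_series n = (\<Sum>l. fps_const (1 / of_nat (n * Suc l)) * fps_X ^ (n * Suc l))"

(* The case i = j = k = 0 is excluded in the theorem; the value 0 there is a dummy.
   All divisions below are exact. *)
definition chi :: "nat \<Rightarrow> nat \<Rightarrow> nat \<Rightarrow> nat \<Rightarrow> nat" where
  "chi i j k n =
    (if i \<ge> 1 \<and> j = 0 \<and> k = 0 then n\<^sup>2 * tau i n
     else if i \<ge> 1 \<and> j = 0 \<and> k \<ge> 1 then n * (\<Sum>p | p dvd n. p * tau i p * tau k (n div p))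
     else if i \<ge> 1 \<and> j \<ge> 1 \<and> k = 0 then (\<Sum>p | p dvd n. p\<^sup>2 * tau i p * tau j (n div p))
     else if i \<ge> 1 \<and> j \<ge> 1 \<and> k \<ge> 1 then
       (\<Sum>p | p dvd n. \<Sum>q | q dvd n div p.
          p\<^sup>2 * q * tau i p * tau k q * tau j (n div (p * q)))
     else if i = 0 \<and> j = 0 \<and> k \<ge> 1 then n * tau k n
     else if i = 0 \<and> j \<ge> 1 \<and> k \<ge> 1 then (\<Sum>p | p dvd n. p * tau k p * tau j (n div p))
     else if i = 0 \<and> j \<ge> 1 \<and> k = 0 then tau j n
     else 0)"

(* In particular the sum defining log_series n converges for n >= 1. *)
lemma log_series_sums:
  assumes "n \<ge> 1"
  shows "(\<lambda>l. fps_const (1 / of_nat (n * Suc l)) * fps_X ^ (n * Suc l)) sums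
           (Abs_fps (\<lambda>m. if m > 0 \<and> n dvd m then 1 / of_nat m else 0) :: 'a::field_char_0 fps)"
  unfolding sums_def
proof (rule tendsto_fpsI)
  fix m :: nat
  show "\<forall>\<^sub>F N in sequentially.
      fps_nth (\<Sum>l<N. fps_const (1 / of_nat (n * Suc l)) * fps_X ^ (n * Suc l)) m =
      fps_nth (Abs_fps (\<lambda>m. if m > 0 \<and> n dvd m then 1 / of_nat m else 0) :: 'a fps) m"
  proof (rule eventually_sequentiallyI)
    fix N assume N: "m \<le> N"
    have *: "fps_nth (\<Sum>l<N. fps_const (1 / of_nat (n * Suc l)) * fps_X ^ (n * Suc l) :: 'a fps) m
        = (\<Sum>l<N. if m = n * Suc l then 1 / of_nat m else 0)"
      unfolding fps_sum_nth by (intro sum.cong refl) (auto simp: fps_X_power_nth)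
    show "fps_nth (\<Sum>l<N. fps_const (1 / of_nat (n * Suc l)) * fps_X ^ (n * Suc l) :: 'a fps) m =
      fps_nth (Abs_fps (\<lambda>m. if m > 0 \<and> n dvd m then 1 / of_nat m else 0)) m"
    proof (cases "m > 0 \<and> n dvd m")
      case True
      then obtain q where q: "m = n * Suc q" 
        by (metis dvdE gr0_conv_Suc mult_0_right not_less0 old.nat.exhaust)
      have "Suc q \<le> m" using assms q by (metis le_add1 mult_le_mono1 nat_mult_1)
      then have "q < N" using N by simp
      moreover have "(m = n * Suc l) = (l = q)" for l
        using q assms by (metis Suc_inject mult_cancel1 not_one_le_zero)
      ultimately show ?thesis using True unfolding * by simp
    next
      case False
      then show ?thesis using assms unfolding * by (auto intro!: sum.neutral)
    qed
  qed
qed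

end

theory Submission
  imports Defs
begin

text \<open>
  Since \<open>(1 - z\<^sup>m)\<^sup>-\<^sup>a = exp (a m \<Sum>\<^sub>l z\<^sup>m\<^sup>l / (m l))\<close>, the factor of \<open>P\<close> at a tuple with
  partial products \<open>N, D, E\<close> is the \<open>N\<^sup>2 E\<close>-th power of the exponential belonging to
  \<open>m = N D E\<close>. Only finitely many tuples have a given \<open>m\<close>, and collecting them gives the exponent
  \<open>\<Sum>\<^bsub>N D E = n\<^esub> N\<^sup>2 E \<tau>\<^sub>i(N) \<tau>\<^sub>j(D) \<tau>\<^sub>k(E)\<close>, which is \<open>\<chi>(n)\<close> in every case because
  \<open>\<tau>\<^sub>0\<close> is the indicator function of \<open>1\<close>.
\<close>

section \<open>Infinite products of formal power series\<close>

lemma fps_one_mod_mult: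
  fixes f g :: "'a::comm_ring_1 fps"
  assumes f: "\<And>s. s \<le> r \<Longrightarrow> fps_nth f s = fps_nth 1 s"
    and g: "\<And>s. s \<le> r \<Longrightarrow> fps_nth g s = fps_nth h s"
    and "s \<le> r"
  shows "fps_nth (f * g) s = fps_nth h s"
proof -
  have "fps_nth (f * g) s = (\<Sum>t=0..s. fps_nth f t * fps_nth g (s - t))"
    by (simp add: fps_mult_nth)
  also have "\<dots> = (\<Sum>t=0..s. fps_nth 1 t * fps_nth h (s - t))"
    using assms by (intro sum.cong) auto
  also have "\<dots> = fps_nth (1 * h) s"
    by (simp only: fps_mult_nth)
  finally show ?thesis by simp
qed

lemma fps_one_mod_prod:
  fixes f :: "'i \<Rightarrow> 'a::comm_ring_1 fps"
  assumes "\<And>x s. x \<in> F \<Longrightarrow> s \<le> r \<Longrightarrow> fps_nth (f x) s = fps_nth 1 s" and "s \<le> r"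
  shows "fps_nth (prod f F) s = fps_nth 1 s"
  using assms
proof (induction F arbitrary: s rule: infinite_finite_induct)
  case (insert x F)
  show ?case
    unfolding prod.insert[OF insert.hyps]
    by (rule fps_one_mod_mult[where r = r]) (use insert in auto)
qed auto

text \<open>A factor \<open>f x\<close> with \<open>d x > r\<close> is 1 up to degree
  \<open>r\<close>, so it cannot change coefficient \<open>r\<close>. That coefficient is therefore
  constant on all finite sets containing the finitely many \<open>x\<close> with
  \<open>d x \<le> r\<close>. The limit is given explicitly by these truncated products, so that two
  infinite products can be compared through finite ones.\<close>

lemma fps_prod_tendsto_by_degree:
  fixes f :: "'i \<Rightarrow> 'a::comm_ring_1 fps" and d :: "'i \<Rightarrow> nat"
  assumes one_mod: "\<And>x s. x \<in> A \<Longrightarrow> s < d x \<Longrightarrow> fps_nth (f x) s = fps_nth 1 s"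
    and fin: "\<And>r. finite {x\<in>A. d x \<le> r}"
  shows "((\<lambda>F. \<Prod>x\<in>F. f x) \<longlongrightarrow> Abs_fps (\<lambda>r. fps_nth (\<Prod>x | x \<in> A \<and> d x \<le> r. f x) r))
           (finite_subsets_at_top A)"
proof (rule tendsto_fpsI)
  fix r :: nat
  let ?S = "{x\<in>A. d x \<le> r}"
  have "fps_nth (prod f F) r = fps_nth (prod f ?S) r"
    if F: "finite F" "?S \<subseteq> F" "F \<subseteq> A" for F
  proof -
    have "prod f F = prod f (F - ?S) * prod f ?S"
      using F by (intro prod.subset_diff)
    moreover have "fps_nth (prod f (F - ?S) * prod f ?S) r = fps_nth (prod f ?S) r"
    proof (rule fps_one_mod_mult[where r = r])
      fix s assume "s \<le> r"
      then show "fps_nth (prod f (F - ?S)) s = fps_nth 1 s"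
        using F by (intro fps_one_mod_prod[where r = r] one_mod) auto
    qed auto
    ultimately show ?thesis by simp
  qed
  then show "\<forall>\<^sub>F F in finite_subsets_at_top A. fps_nth (prod f F) r =
      fps_nth (Abs_fps (\<lambda>r. fps_nth (\<Prod>x | x \<in> A \<and> d x \<le> r. f x) r)) r"
    unfolding eventually_finite_subsets_at_top fps_nth_Abs_fps using fin[of r]
    by (intro exI[of _ ?S]) blast
qed

lemma fps_infprod_eqI:
  assumes "((\<lambda>F. \<Prod>x\<in>F. f x) \<longlongrightarrow> L) (finite_subsets_at_top A)"
  shows "fps_infprod f A = L"
  unfolding fps_infprod_def using assms by (intro tendsto_Lim) auto

section \<open>The factors as exponentials\<close>

text \<open>Coefficient \<open>m\<close> of the equation expresses \<open>Suc m\<close> times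
  coefficient \<open>Suc m\<close> of the solution through lower coefficients; in characteristic 0
  this determines the solution from its constant term.\<close>

lemma fps_linear_ODE_unique:
  fixes f g \<phi> :: "'a::field_char_0 fps"
  assumes f: "fps_deriv f = \<phi> * f" and g: "fps_deriv g = \<phi> * g"
    and "fps_nth f 0 = fps_nth g 0"
  shows "f = g"
proof (rule fps_ext)
  fix n
  show "fps_nth f n = fps_nth g n"
  proof (induction n rule: less_induct)
    case (less n)
    show ?case
    proof (cases n)
      case 0
      then show ?thesis using assms by simp
    next
      case (Suc m)
      have "fps_nth (fps_deriv f) m = fps_nth (fps_deriv g) m"
        unfolding f g fps_mult_nth using less Suc by (intro sum.cong) auto
      then have "of_nat (Suc m) * fps_nth f n = of_nat (Suc m) * fps_nth g n"
        using Suc by simp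
      then show ?thesis
        by (metis mult_cancel_left of_nat_eq_0_iff nat.distinct(1))
    qed
  qed
qed

lemma log_series_eq:
  assumes "m \<ge> 1"
  shows "log_series m =
    (Abs_fps (\<lambda>r. if r > 0 \<and> m dvd r then 1 / of_nat r else 0) :: 'a::field_char_0 fps)"
  unfolding log_series_def using log_series_sums[OF assms] by (rule sums_unique[symmetric])

text \<open>The derivative is the geometric series of
  \<open>fps_X ^ (m - 1) / (1 - fps_X ^ m)\<close>, its coefficient at \<open>s\<close> being 1
  exactly when \<open>m\<close> divides \<open>Suc s\<close>. Multiplying by
  \<open>1 - fps_X ^ m\<close> telescopes it to its first term.\<close>

lemma fps_deriv_log_series:
  assumes "m \<ge> 1"
  shows "(1 - fps_X ^ m) * fps_deriv (log_series m) = (fps_X ^ (m - 1) :: 'a::field_char_0 fps)"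
proof (rule fps_ext)
  fix r
  have D: "fps_nth (fps_deriv (log_series m :: 'a fps)) s = (if m dvd Suc s then 1 else 0)" for s
    using assms by (simp add: log_series_eq del: of_nat_Suc)
  have "m dvd Suc r \<longleftrightarrow> r = m - 1" if "r < m"
    using that assms by (auto dest: dvd_imp_le)
  moreover have "m dvd Suc (r - m) \<longleftrightarrow> m dvd Suc r" if "\<not> r < m"
  proof -
    have "Suc r = Suc (r - m) + m" using that by simp
    then show ?thesis by (simp only: dvd_add_triv_right_iff)
  qed
  ultimately show "fps_nth ((1 - fps_X ^ m) * fps_deriv (log_series m)) r =
      fps_nth (fps_X ^ (m - 1) :: 'a fps) r"
    using assms
    by (auto simp: left_diff_distrib fps_X_power_mult_nth D fps_X_power_nth simp del: fps_deriv_nth)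
qed

lemma fps_exp_of_power:
  fixes f :: "'a::field_char_0 fps"
  assumes "fps_nth f 0 = 0"
  shows "fps_exp_of f ^ c = fps_exp (of_nat c) oo f"
  using fps_compose_power[OF assms, of "fps_exp 1" c]
  by (simp add: fps_exp_of_def fps_exp_power_mult)

text \<open>Both sides have constant term 1 and satisfy
  \<open>(1 - fps_X ^ m) * F' = c * fps_X ^ (m - 1) * F\<close>, so uniqueness for linear
  differential equations identifies them. No formal logarithm is involved.\<close>

lemma fps_gpow_eq_exp_log_series_power:
  fixes a :: "'a::field_char_0"
  assumes m: "m \<ge> 1" and c: "a * of_nat m = of_nat c"
  shows "fps_gpow (1 - fps_X ^ m) (- a) = fps_exp_of (log_series m) ^ c"
proof -
  let ?u = "- (fps_X ^ m) :: 'a fps" and ?L = "log_series m :: 'a fps"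
  let ?A = "fps_binomial (- a) oo ?u" and ?B = "fps_exp (of_nat c) oo ?L"
  let ?\<phi> = "fps_const (of_nat c) * fps_X ^ (m - 1) * inverse (1 - fps_X ^ m) :: 'a fps"
  have u0: "fps_nth ?u 0 = 0" and L0: "fps_nth ?L 0 = 0"
    using m by (auto simp: log_series_eq)
  have inv: "inverse (1 - fps_X ^ m) * (1 - fps_X ^ m) = (1 :: 'a fps)"
    using m by (intro inverse_mult_eq_1) auto
  have solve: "fps_deriv f = ?\<phi> * f"
    if "(1 - fps_X ^ m) * fps_deriv f = fps_const (of_nat c) * fps_X ^ (m - 1) * f"
    for f :: "'a fps"
  proof -
    have "fps_deriv f = inverse (1 - fps_X ^ m) * (1 - fps_X ^ m) * fps_deriv f"
      by (simp add: inv)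
    also have "\<dots> = inverse (1 - fps_X ^ m) * ((1 - fps_X ^ m) * fps_deriv f)"
      by (simp only: mult.assoc)
    also have "\<dots> = ?\<phi> * f"
      by (simp only: that) (simp only: mult_ac)
    finally show ?thesis .
  qed
  \<comment> \<open>The differential equation of the binomial series, with denominator cleared so
    that \<open>?u\<close> can be substituted for the variable.\<close>
  have "(1 + fps_X) * fps_deriv (fps_binomial (- a)) = fps_const (- a) * fps_binomial (- a)"
    by (simp add: fps_binomial_deriv fps_divide_unit inverse_mult_eq_1' mult.left_commute)
  then have "((1 + fps_X) * fps_deriv (fps_binomial (- a))) oo ?u
      = (fps_const (- a) * fps_binomial (- a)) oo ?u"
    by simp
  then have bin: "(1 - fps_X ^ m) * (fps_deriv (fps_binomial (- a)) oo ?u) = fps_const (- a) * ?A"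
    using u0 by (simp add: fps_compose_mult_distrib fps_compose_add_distrib)
  have "(1 - fps_X ^ m) * fps_deriv ?A =
      (1 - fps_X ^ m) * (fps_deriv (fps_binomial (- a)) oo ?u) * fps_deriv ?u"
    using u0 by (simp only: fps_compose_deriv mult.assoc)
  also have "\<dots> = fps_const (- a) * ?A * fps_deriv ?u"
    by (simp only: bin)
  also have "fps_deriv ?u = - (fps_const (of_nat m) * fps_X ^ (m - 1))"
    by (simp add: fps_deriv_power' fps_of_nat)
  also have "fps_const (- a) * ?A * - (fps_const (of_nat m) * fps_X ^ (m - 1)) =
      fps_const (a * of_nat m) * fps_X ^ (m - 1) * ?A"
    by (simp flip: fps_const_mult fps_const_neg add: mult_ac)
  finally have A: "(1 - fps_X ^ m) * fps_deriv ?A = fps_const (of_nat c) * fps_X ^ (m - 1) * ?A"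
    by (simp only: c)
  have "(1 - fps_X ^ m) * fps_deriv ?B =
      fps_const (of_nat c) * ((1 - fps_X ^ m) * fps_deriv ?L) * ?B"
    using L0 by (simp add: fps_compose_deriv fps_compose_mult_distrib mult_ac)
  then have B: "(1 - fps_X ^ m) * fps_deriv ?B = fps_const (of_nat c) * fps_X ^ (m - 1) * ?B"
    by (simp only: fps_deriv_log_series[OF m])
  have "?A = ?B"
    by (rule fps_linear_ODE_unique[OF solve[OF A] solve[OF B]]) simp
  then show ?thesis
    using L0 by (simp add: fps_gpow_def fps_exp_of_power)
qed

text \<open>Every positive power of \<open>g\<close> vanishes below degree \<open>m\<close>, so only
  the constant term of \<open>f\<close> contributes there.\<close>

lemma fps_compose_nth_below:
  fixes f g :: "'a::comm_ring_1 fps"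
  assumes "\<And>r. r < m \<Longrightarrow> fps_nth g r = 0" and "s < m"
  shows "fps_nth (f oo g) s = fps_nth (fps_const (fps_nth f 0)) s"
proof -
  have "fps_nth (g ^ Suc t) s = 0" for t
    using assms by (auto simp: fps_mult_nth intro!: sum.neutral)
  then have "fps_nth (g ^ t) s = 0" if "t \<noteq> 0" for t
    using that by (metis not0_implies_Suc)
  then have "(\<Sum>t=0..s. fps_nth f t * fps_nth (g ^ t) s) = (\<Sum>t\<in>{0}. fps_nth f t * fps_nth (g ^ t) s)"
    by (intro sum.mono_neutral_right) auto
  then show ?thesis
    by (simp add: fps_compose_nth)
qed

text \<open>This supplies the degree condition for convergence of both infinite products, with
  degree \<open>index_prod x\<close> for the factor at a tuple \<open>x\<close> and degree
  \<open>n\<close> for the factor at \<open>n\<close>.\<close>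

lemma fps_exp_log_series_power_nth_below:
  assumes "m \<ge> 1" and "s < m"
  shows "fps_nth (fps_exp_of (log_series m :: 'a::field_char_0 fps) ^ c) s = fps_nth 1 s"
proof -
  have below: "fps_nth (log_series m :: 'a fps) r = 0" if "r < m" for r
    using that assms by (auto simp: log_series_eq dest: dvd_imp_le)
  show ?thesis
    using assms fps_compose_nth_below[OF below \<open>s < m\<close>]
    by (simp add: fps_exp_of_power below)
qed

section \<open>Counting the index tuples\<close>

definition index_prod :: "nat list \<times> nat list \<times> nat list \<Rightarrow> nat" where
  "index_prod = (\<lambda>(ns, ds, es). prod_list ns * prod_list ds * prod_list es)"

text \<open>With partial products N, D, E this is (N / D) * (N D E): the exponent of the factor
  times \<open>index_prod\<close>. The denominator cancels, so ordinary natural powers suffice from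
  here on.\<close>

definition index_mult :: "nat list \<times> nat list \<times> nat list \<Rightarrow> nat" where
  "index_mult = (\<lambda>(ns, ds, es). (prod_list ns)\<^sup>2 * prod_list es)"

lemma pos_tuples_prod_pos: "as \<in> pos_tuples m \<Longrightarrow> prod_list as > 0"
  unfolding pos_tuples_def by (induction as arbitrary: m) auto

lemma index_prod_pos: "x \<in> P_indices i j k \<Longrightarrow> index_prod x > 0"
  by (auto simp: P_indices_def index_prod_def pos_tuples_prod_pos)

lemma tau_eq_card: "tau m n = card {as \<in> pos_tuples m. prod_list as = n}"
  by (simp add: tau_def pos_tuples_def conj_assoc)

lemma tau_0: "tau 0 n = (if n = 1 then 1 else 0)"
proof -
  have "{as :: nat list. length as = 0 \<and> (\<forall>a\<in>set as. a > 0) \<and> prod_list as = n} =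
      (if n = 1 then {[]} else {})"
    by auto
  then show ?thesis by (simp add: tau_def)
qed

text \<open>Each entry divides the positive product and is thus at most \<open>r\<close>, leaving
  finitely many lists of length \<open>m\<close>.\<close>

lemma finite_pos_tuples_prod_le: "finite {as \<in> pos_tuples m. prod_list as \<le> r}"
proof (rule finite_subset)
  show "{as \<in> pos_tuples m. prod_list as \<le> r} \<subseteq> {as. set as \<subseteq> {..r} \<and> length as = m}"
  proof clarsimp
    fix as a assume as: "as \<in> pos_tuples m" "prod_list as \<le> r"
    have "a \<le> r" if "a \<in> set as" for a
    proof -
      have "a dvd prod_list as" using that by (rule prod_list_dvd)
      then show ?thesis using as pos_tuples_prod_pos[OF as(1)] by (auto dest: dvd_imp_le)
    qed
    then show "set as \<subseteq> {..r} \<and> length as = m" using as by (auto simp: pos_tuples_def)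
  qed
qed (simp add: finite_lists_length_eq)

lemma finite_index_prod_le: "finite {x \<in> P_indices i j k. index_prod x \<le> r}"
proof (rule finite_subset)
  let ?T = "\<lambda>m. {as \<in> pos_tuples m. prod_list as \<le> r}"
  show "{x \<in> P_indices i j k. index_prod x \<le> r} \<subseteq> ?T i \<times> ?T j \<times> ?T k"
  proof (clarsimp simp: P_indices_def index_prod_def)
    fix ns ds es
    assume x: "ns \<in> pos_tuples i" "ds \<in> pos_tuples j" "es \<in> pos_tuples k"
      and le: "prod_list ns * prod_list ds * prod_list es \<le> r"
    have "a \<le> r" if "a dvd prod_list ns * prod_list ds * prod_list es" for a
      using dvd_imp_le[OF that] le x[THEN pos_tuples_prod_pos] by simp
    then show "prod_list ns \<le> r \<and> prod_list ds \<le> r \<and> prod_list es \<le> r"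
      by simp
  qed
qed (simp add: finite_pos_tuples_prod_le)

text \<open>The tuples are grouped by the pair (N, E) = (p, q), which forces D = n / (p q). On each
  group the weight is constant, and the group is a product of three sets counted by
  \<open>tau\<close>.\<close>

lemma sum_index_mult:
  assumes n: "n \<ge> 1"
  shows "(\<Sum>x | x \<in> P_indices i j k \<and> index_prod x = n. index_mult x) =
    (\<Sum>p | p dvd n. \<Sum>q | q dvd n div p. p\<^sup>2 * q * tau i p * tau k q * tau j (n div (p * q)))"
proof -
  let ?S = "{x \<in> P_indices i j k. index_prod x = n}"
  let ?T = "SIGMA p:{p. p dvd n}. {q. q dvd n div p}"
  let ?key = "\<lambda>(ns, ds, es). (prod_list ns, prod_list es) :: nat \<times> nat"
  let ?fib = "\<lambda>m a. {as \<in> pos_tuples m. prod_list as = a}"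
  have finS: "finite ?S"
    by (rule finite_subset[OF _ finite_index_prod_le[of i j k n]]) auto
  have fin: "finite {p. p dvd n}" "\<And>p. p dvd n \<Longrightarrow> finite {q. q dvd n div p}"
    using n by (auto simp: finite_divisors_nat dvd_div_eq_0_iff intro!: finite_divisors_nat Nat.gr0I)
  have sub: "?key ` ?S \<subseteq> ?T"
    by (auto simp: P_indices_def index_prod_def mult.assoc dest: pos_tuples_prod_pos)
  have "(\<Sum>x\<in>?S. index_mult x) = (\<Sum>t\<in>?T. \<Sum>x | x \<in> ?S \<and> ?key x = t. index_mult x)"
    using finS fin sub by (intro sum.group[symmetric]) auto
  also have "\<dots> = (\<Sum>(p, q)\<in>?T. p\<^sup>2 * q * tau i p * tau k q * tau j (n div (p * q)))"
  proof (intro sum.cong refl, clarify)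
    fix p q assume pq: "p dvd n" "q dvd n div p"
    then obtain b where b: "n = p * q * b"
      by (metis dvd_div_mult_self dvd_def mult.assoc mult.commute)
    have pos: "p > 0" "q > 0" using n b by (auto intro: Nat.gr0I)
    have div: "n div (p * q) = b" using b pos by simp
    \<comment> \<open>Cancelling the positive number \<open>p * q\<close> in
      \<open>n = p * q * b\<close> turns the condition on the total product into
      \<open>prod_list ds = b\<close>.\<close>
    have "{x \<in> ?S. ?key x = (p, q)} = ?fib i p \<times> ?fib j b \<times> ?fib k q"
      using pos by (auto simp: P_indices_def index_prod_def b)
    moreover have "(\<Sum>x\<in>?fib i p \<times> ?fib j b \<times> ?fib k q. index_mult x) =
        (\<Sum>x\<in>?fib i p \<times> ?fib j b \<times> ?fib k q. p\<^sup>2 * q)"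
      by (intro sum.cong) (auto simp: index_mult_def)
    ultimately show "(\<Sum>x | x \<in> ?S \<and> ?key x = (p, q). index_mult x) =
        p\<^sup>2 * q * tau i p * tau k q * tau j (n div (p * q))"
      by (simp add: div tau_eq_card card_cartesian_product)
  qed
  also have "\<dots> = (\<Sum>p | p dvd n. \<Sum>q | q dvd n div p.
      p\<^sup>2 * q * tau i p * tau k q * tau j (n div (p * q)))"
    using fin by (intro sum.Sigma[symmetric]) auto
  finally show ?thesis .
qed

lemma sum_divisors_tau_0_left:
  fixes g :: "nat \<Rightarrow> nat"
  assumes "n \<ge> 1"
  shows "(\<Sum>p | p dvd n. g p * tau 0 p) = g 1"
proof -
  have "(\<Sum>p | p dvd n. g p * tau 0 p) = (\<Sum>p\<in>{1}. g p * tau 0 p)"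
    using assms by (intro sum.mono_neutral_right) (auto simp: tau_0 finite_divisors_nat)
  then show ?thesis by (simp add: tau_0)
qed

lemma sum_divisors_tau_0_right:
  fixes g :: "nat \<Rightarrow> nat"
  assumes "n \<ge> 1"
  shows "(\<Sum>p | p dvd n. g p * tau 0 (n div p)) = g n"
proof -
  have "(\<Sum>p | p dvd n. g p * tau 0 (n div p)) = (\<Sum>p\<in>{n}. g p * tau 0 (n div p))"
    using assms
    by (intro sum.mono_neutral_right) (auto simp: tau_0 finite_divisors_nat elim!: dvdE)
  then show ?thesis using assms by (simp add: tau_0)
qed

text \<open>The double sum of the generic case covers all others: a factor \<open>tau 0\<close>
  keeps only \<open>q = 1\<close> when \<open>k = 0\<close>, only \<open>q = n div p\<close> when
  \<open>j = 0\<close>, and only \<open>p = 1\<close> when \<open>i = 0\<close>.\<close>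

lemma chi_eq_sum:
  assumes ijk: "i + j + k \<ge> 1" and n: "n \<ge> 1"
  shows "chi i j k n =
    (\<Sum>p | p dvd n. \<Sum>q | q dvd n div p. p\<^sup>2 * q * tau i p * tau k q * tau j (n div (p * q)))"
    (is "_ = (\<Sum>p | p dvd n. ?inner p)")
proof -
  have pos: "n div p \<ge> 1" if "p dvd n" for p
    using that n by (auto elim!: dvdE)
  have k0: "?inner p = p\<^sup>2 * tau i p * tau j (n div p)" if "p dvd n" "k = 0" for p
    using sum_divisors_tau_0_left[OF pos[OF \<open>p dvd n\<close>],
        of "\<lambda>q. p\<^sup>2 * q * tau i p * tau j (n div (p * q))"] that
    by (simp add: mult_ac)
  have j0: "?inner p = n * (p * tau i p * tau k (n div p))" if "p dvd n" "j = 0" for p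
  proof -
    \<comment> \<open>Writing the argument of \<open>tau 0\<close> as the cofactor of
      \<open>q\<close> in \<open>n div p\<close> makes this a divisor sum of \<open>n div p\<close>,
      in which only the largest divisor survives.\<close>
    have "?inner p = (\<Sum>q | q dvd n div p. p\<^sup>2 * q * tau i p * tau k q * tau 0 (n div p div q))"
      by (simp add: div_mult2_eq \<open>j = 0\<close>)
    also have "\<dots> = p\<^sup>2 * (n div p) * tau i p * tau k (n div p)"
      by (rule sum_divisors_tau_0_right[OF pos[OF \<open>p dvd n\<close>]])
    also have "\<dots> = (p * (n div p)) * (p * tau i p * tau k (n div p))"
      by (simp only: power2_eq_square mult_ac)
    finally show ?thesis
      using \<open>p dvd n\<close> by simp
  qed
  have i0: "(\<Sum>p | p dvd n. ?inner p) = (\<Sum>q | q dvd n. q * tau k q * tau j (n div q))" if "i = 0"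
  proof -
    \<comment> \<open>The factor \<open>tau 0 p\<close> does not depend on \<open>q\<close> and is
      pulled out of the inner sum to collapse the outer one.\<close>
    have "(\<Sum>p | p dvd n. ?inner p) = (\<Sum>p | p dvd n.
        (\<Sum>q | q dvd n div p. p\<^sup>2 * q * tau k q * tau j (n div (p * q))) * tau 0 p)"
      by (simp add: that sum_distrib_left mult_ac)
    also have "\<dots> = (\<Sum>q | q dvd n. q * tau k q * tau j (n div q))"
      by (subst sum_divisors_tau_0_left[OF n]) simp
    finally show ?thesis .
  qed
  consider "i \<ge> 1" "j = 0" "k = 0" | "i \<ge> 1" "j = 0" "k \<ge> 1" | "i \<ge> 1" "j \<ge> 1" "k = 0"
    | "i \<ge> 1" "j \<ge> 1" "k \<ge> 1" | "i = 0" "j = 0" "k \<ge> 1" | "i = 0" "j \<ge> 1" "k \<ge> 1"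
    | "i = 0" "j \<ge> 1" "k = 0"
    using ijk by linarith
  then show ?thesis
  proof cases
    case 1
    have "(\<Sum>p | p dvd n. ?inner p) = (\<Sum>p | p dvd n. p\<^sup>2 * tau i p * tau 0 (n div p))"
      using 1 k0 by (intro sum.cong) auto
    also have "\<dots> = n\<^sup>2 * tau i n"
      by (rule sum_divisors_tau_0_right[OF n])
    finally show ?thesis using 1 by (simp add: chi_def)
  next
    case 2
    have "(\<Sum>p | p dvd n. ?inner p) = (\<Sum>p | p dvd n. n * (p * tau i p * tau k (n div p)))"
      using 2 j0 by (intro sum.cong) auto
    then show ?thesis using 2 by (simp add: chi_def sum_distrib_left)
  next
    case 3
    have "(\<Sum>p | p dvd n. ?inner p) = (\<Sum>p | p dvd n. p\<^sup>2 * tau i p * tau j (n div p))"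
      using 3 k0 by (intro sum.cong) auto
    then show ?thesis using 3 by (simp add: chi_def)
  next
    case 4
    then show ?thesis by (simp add: chi_def)
  next
    case 5
    then show ?thesis
      using i0 sum_divisors_tau_0_right[OF n, of "\<lambda>q. q * tau k q"] by (simp add: chi_def)
  next
    case 6
    then show ?thesis using i0 by (simp add: chi_def)
  next
    case 7
    then show ?thesis
      using i0 sum_divisors_tau_0_left[OF n, of "\<lambda>q. q * tau j (n div q)"]
      by (simp add: chi_def mult_ac)
  qed
qed

section \<open>The product formula\<close>

lemma P_factor_eq:
  assumes "x \<in> P_indices i j k"
  shows "(P_factor x :: 'a::field_char_0 fps) =
    fps_exp_of (log_series (index_prod x)) ^ index_mult x"
proof -
  obtain ns ds es where x: "x = (ns, ds, es)" by (cases x)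
  have "prod_list ds > 0"
    using assms by (auto simp: x P_indices_def dest: pos_tuples_prod_pos)
  then have "(of_nat (prod_list ns) / of_nat (prod_list ds)) * of_nat (index_prod x) =
      (of_nat (index_mult x) :: 'a)"
    by (simp add: x index_prod_def index_mult_def power2_eq_square)
  moreover have "index_prod x \<ge> 1"
    using index_prod_pos[OF assms] by simp
  ultimately show ?thesis
    using fps_gpow_eq_exp_log_series_power[of "index_prod x"
        "of_nat (prod_list ns) / of_nat (prod_list ds) :: 'a" "index_mult x"]
    by (simp add: P_factor_def x index_prod_def)
qed

text \<open>The finite form of the product formula: the tuples are grouped by
  \<open>index_prod\<close>, and within the group of \<open>n\<close> the exponents of a common base
  add up to \<open>chi i j k n\<close>. The truncated products agree as whole series, not only up to
  degree \<open>r\<close>.\<close>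

lemma prod_P_factor_index_prod_le:
  assumes "i + j + k \<ge> 1"
  shows "(\<Prod>x | x \<in> P_indices i j k \<and> index_prod x \<le> r. P_factor x) =
    (\<Prod>n | n \<in> {1..} \<and> n \<le> r. fps_exp_of (log_series n :: 'a::field_char_0 fps) ^ chi i j k n)"
proof -
  let ?h = "\<lambda>n. fps_exp_of (log_series n :: 'a fps)"
  let ?S = "{x \<in> P_indices i j k. index_prod x \<le> r}" and ?N = "{n. n \<in> {1..} \<and> n \<le> r}"
  have "(\<Prod>x\<in>?S. P_factor x :: 'a fps) = (\<Prod>n\<in>?N. \<Prod>x | x \<in> ?S \<and> index_prod x = n. P_factor x)"
    using index_prod_pos finite_index_prod_le
    by (intro prod.group[symmetric]) (fastforce simp: Suc_le_eq)+
  also have "\<dots> = (\<Prod>n\<in>?N. ?h n ^ chi i j k n)"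
  proof (intro prod.cong refl)
    fix n assume "n \<in> ?N"
    then have n: "n \<ge> 1" "n \<le> r" by auto
    have "(\<Prod>x | x \<in> ?S \<and> index_prod x = n. P_factor x) =
        (\<Prod>x | x \<in> P_indices i j k \<and> index_prod x = n. ?h n ^ index_mult x)"
      using n by (intro prod.cong) (auto simp: P_factor_eq)
    also have "\<dots> = ?h n ^ (\<Sum>x | x \<in> P_indices i j k \<and> index_prod x = n. index_mult x)"
      by (rule power_sum[symmetric])
    also have "\<dots> = ?h n ^ chi i j k n"
      by (simp only: sum_index_mult[OF n(1)] chi_eq_sum[OF assms n(1)])
    finally show "(\<Prod>x | x \<in> ?S \<and> index_prod x = n. P_factor x) = ?h n ^ chi i j k n" .
  qed
  finally show ?thesis .
qed

theorem theorem3p2: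
  fixes i j k :: nat
  assumes "i + j + k \<ge> 1"
  shows "fps_multipliable_on (P_factor :: _ \<Rightarrow> 'a::field_char_0 fps) (P_indices i j k) \<and>
         fps_multipliable_on (\<lambda>n. fps_exp_of (log_series n :: 'a fps) ^ chi i j k n) {1..} \<and>
         fps_infprod (P_factor :: _ \<Rightarrow> 'a fps) (P_indices i j k) =
           fps_infprod (\<lambda>n. fps_exp_of (log_series n) ^ chi i j k n) {1..}"
proof -
  let ?g = "\<lambda>n. fps_exp_of (log_series n :: 'a fps) ^ chi i j k n"
  let ?L = "Abs_fps (\<lambda>r. fps_nth (\<Prod>n | n \<in> {1..} \<and> n \<le> r. ?g n) r)"
  \<comment> \<open>Read from right to left, the finite product formula turns \<open>?L\<close> into
    the limit built from truncated products over tuples, so both infinite products converge to the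
    same series.\<close>
  have P: "((\<lambda>F. \<Prod>x\<in>F. P_factor x) \<longlongrightarrow> ?L) (finite_subsets_at_top (P_indices i j k))"
    unfolding prod_P_factor_index_prod_le[OF assms, symmetric]
  proof (rule fps_prod_tendsto_by_degree[OF _ finite_index_prod_le])
    fix x s assume x: "x \<in> P_indices i j k" "s < index_prod x"
    then show "fps_nth (P_factor x :: 'a fps) s = fps_nth 1 s"
      unfolding P_factor_eq[OF x(1)] by (intro fps_exp_log_series_power_nth_below) auto
  qed
  have G: "((\<lambda>F. \<Prod>n\<in>F. ?g n) \<longlongrightarrow> ?L) (finite_subsets_at_top {1..})"
  proof (rule fps_prod_tendsto_by_degree)
    fix n s :: nat assume "n \<in> {1..}" "s < n"
    then show "fps_nth (?g n) s = fps_nth 1 s"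
      by (intro fps_exp_log_series_power_nth_below) auto
  qed (auto intro: finite_subset[of _ "{..r}" for r])
  show ?thesis
    unfolding fps_multipliable_on_def fps_infprod_eqI[OF P] fps_infprod_eqI[OF G]
    using P G by blast
qed

end
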